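(* Let the sequence $(b_0,b_1,\ldots)$ be defined by $b_0:=0$ and $b_k:=E_{2k-2}$ for $k\ge1$, where $E_j$ are the Euler numbers. Then for all $n\ge1$, $$H_n(b_k)=\frac{(-1)^n}{4^n\,n!^2}\cdot\mathcal{K}_n\cdot H_n(E_{2k}),\qquad\text{where}\quad \mathcal{K}_n:=\sum_{j=0}^{n-1}\frac{16^j}{(2j+1)^2\binom{2j}{j}^2}.$$
   Context: For a sequence $(a_k)_{k\ge 0}$ and $n\ge 0$, $H_n(a_k):=\det(a_{i+j})_{0\le i,j\le n}$ denotes the $(n+1)\times(n+1)$ Hankel determinant; all sequences are indexed by $k\ge0$. The Euler numbers are defined by $\frac{2}{e^t+e^{-t}}=\sum_{n\ge0}E_n\frac{t^n}{n!}$. The notation $n!^2$ means $(n!)^2$. *)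

theory Defs
  imports
    "HOL-Computational_Algebra.Formal_Power_Series"
    "Jordan_Normal_Form.Determinant"
begin

definition euler_number :: "nat \<Rightarrow> real" where
  "euler_number n = fact n * fps_nth (2 / (fps_exp 1 + fps_exp (-1))) n"

text \<open>The index is the largest row index, so the matrix has size \<open>n + 1\<close>.\<close>

definition hankel_det :: "nat \<Rightarrow> (nat \<Rightarrow> 'a :: comm_ring_1) \<Rightarrow> 'a" where
  "hankel_det n a = det (mat (n + 1) (n + 1) (\<lambda>(i, j). a (i + j)))"

definition b_seq :: "nat \<Rightarrow> real" where
  "b_seq k = (if k = 0 then 0 else euler_number (2 * k - 2))"

definition K_sum :: "nat \<Rightarrow> real" where
  "K_sum n = (\<Sum>j = 0..<n. 16 ^ j / (real (2 * j + 1) ^ 2 * real ((2 * j) choose j) ^ 2))"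

end

theory Submission
  imports Defs
begin

text \<open>
  Put \<open>B\<^sub>i\<^sub>,\<^sub>m = i! [t\<^sup>i] sech t tanh\<^sup>m t\<close>. Comparing coefficients in the expansion
  \<open>sech (s + t) = \<Sum>m. (-1)\<^sup>m (sech s tanh\<^sup>m s) (sech t tanh\<^sup>m t)\<close> gives
  \<open>E\<^sub>i\<^sub>+\<^sub>j = \<Sum>m. (-1)\<^sup>m B\<^sub>i\<^sub>,\<^sub>m B\<^sub>j\<^sub>,\<^sub>m\<close>, where \<open>B\<close> is lower triangular and vanishes for odd
  \<open>i + m\<close>. Its even part is an LDL factorisation of the Hankel matrix of \<open>E\<^sub>2\<^sub>k\<close>, and its odd part
  one of the Hankel matrix of \<open>E\<^sub>2\<^sub>k\<^sub>+\<^sub>2\<close>. The matrix of \<open>b\<^sub>k\<close> borders the latter by the vector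
  \<open>E\<^sub>2\<^sub>j\<close>, which has coordinates \<open>u\<^sub>m = 4\<^sup>m m!\<^sup>2 / (2m+1)!\<close> in the columns of the odd part of \<open>B\<close>;
  hence the Schur complement of the border is \<open>\<Sum>m<n. u\<^sub>m\<^sup>2\<close>, and this is \<open>K\<^sub>n\<close>.
\<close>

section \<open>Hyperbolic secant and tangent as formal power series\<close>

definition fps_sech :: "real fps" where
  "fps_sech = 2 / (fps_exp 1 + fps_exp (-1))"

definition fps_tanh :: "real fps" where
  "fps_tanh = (fps_exp 1 - fps_exp (-1)) / (fps_exp 1 + fps_exp (-1))"

lemma fps_exp_sum_nz: "(fps_exp 1 + fps_exp (-1) :: real fps) \<noteq> 0"
proof
  assume "(fps_exp 1 + fps_exp (-1) :: real fps) = 0"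
  then have "fps_nth (fps_exp 1 + fps_exp (-1) :: real fps) 0 = 0" by simp
  then show False by simp
qed

lemma fps_divide_unit_mult:
  fixes f g :: "real fps"
  assumes "fps_nth g 0 \<noteq> 0"
  shows "f / g * g = f"
  using assms by (simp add: fps_divide_unit mult.assoc inverse_mult_eq_1)

lemma fps_sech_mult: "fps_sech * (fps_exp 1 + fps_exp (-1)) = 2"
  unfolding fps_sech_def by (rule fps_divide_unit_mult) simp

lemma fps_tanh_mult: "fps_tanh * (fps_exp 1 + fps_exp (-1)) = fps_exp 1 - fps_exp (-1)"
  unfolding fps_tanh_def by (rule fps_divide_unit_mult) simp

lemma fps_sech_nth_0: "fps_nth fps_sech 0 = 1"
  using arg_cong[OF fps_sech_mult, of "\<lambda>f. fps_nth f 0"] by (simp add: fps_numeral_nth)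

lemma fps_tanh_nth_0: "fps_nth fps_tanh 0 = 0"
  using arg_cong[OF fps_tanh_mult, of "\<lambda>f. fps_nth f 0"] by simp

text \<open>Differentiating the product of \<open>fps_sech\<close> with its denominator
  \<open>?P\<close>, which is constant, and cancelling \<open>?P\<close> replaces the quotient
  rule.\<close>

lemma fps_deriv_sech: "fps_deriv fps_sech = - fps_sech * fps_tanh"
proof -
  let ?P = "fps_exp 1 + fps_exp (-1) :: real fps" and ?Q = "fps_exp 1 - fps_exp (-1) :: real fps"
  have "fps_deriv (fps_sech * ?P) = 0"
    unfolding fps_sech_mult by (simp add: fps_deriv_numeral)
  moreover have "fps_deriv ?P = ?Q" by (simp flip: fps_const_neg)
  ultimately have "fps_deriv fps_sech * ?P + fps_sech * ?Q = 0"
    by (simp only: fps_deriv_mult add.commute)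
  then have "fps_deriv fps_sech * ?P = (- fps_sech * fps_tanh) * ?P"
    unfolding fps_tanh_mult[symmetric] by (simp only: eq_neg_iff_add_eq_0 mult_minus_left mult.assoc)
  then show ?thesis using fps_exp_sum_nz by (metis mult_right_cancel)
qed

lemma fps_deriv_tanh: "fps_deriv fps_tanh = 1 - fps_tanh ^ 2"
proof -
  let ?P = "fps_exp 1 + fps_exp (-1) :: real fps" and ?Q = "fps_exp 1 - fps_exp (-1) :: real fps"
  have "fps_deriv ?P = ?Q" "fps_deriv ?Q = ?P" by (simp_all flip: fps_const_neg)
  then have "fps_deriv fps_tanh * ?P + fps_tanh * ?Q = ?P"
    using arg_cong[OF fps_tanh_mult, of fps_deriv] by (simp only: fps_deriv_mult add.commute)
  then have "fps_deriv fps_tanh * ?P = (1 - fps_tanh ^ 2) * ?P"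
    unfolding fps_tanh_mult[symmetric] by (simp add: algebra_simps power2_eq_square)
  then show ?thesis using fps_exp_sum_nz by (metis mult_right_cancel)
qed

section \<open>Taylor coefficients of sech times powers of tanh\<close>

definition sech_tanh_coeff :: "nat \<Rightarrow> nat \<Rightarrow> real" where
  "sech_tanh_coeff i m = fact i * fps_nth (fps_sech * fps_tanh ^ m) i"

lemma euler_number_eq_coeff: "euler_number i = sech_tanh_coeff i 0"
  by (simp add: euler_number_def sech_tanh_coeff_def fps_sech_def)

text \<open>At \<open>m = 0\<close> the truncated exponent \<open>m - 1\<close> is harmless, because
  its factor \<open>of_nat m\<close> vanishes.\<close>

lemma fps_deriv_sech_tanh_power:
  "fps_deriv (fps_sech * fps_tanh ^ m) =
     of_nat m * (fps_sech * fps_tanh ^ (m - 1)) - of_nat (m + 1) * (fps_sech * fps_tanh ^ (m + 1))"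
proof (cases m)
  case 0
  then show ?thesis by (simp add: fps_deriv_sech)
next
  case (Suc k)
  have "fps_deriv (fps_tanh ^ Suc k) = of_nat (Suc k) * (1 - fps_tanh ^ 2) * fps_tanh ^ k"
    by (simp only: fps_deriv_power fps_deriv_tanh fps_of_nat diff_Suc_1)
  then show ?thesis
    unfolding Suc fps_deriv_mult fps_deriv_sech
    by (simp only:) (simp add: algebra_simps power2_eq_square)
qed

lemma sech_tanh_coeff_Suc:
  "sech_tanh_coeff (Suc i) m =
     real m * sech_tanh_coeff i (m - 1) - real (m + 1) * sech_tanh_coeff i (m + 1)"
proof -
  have "sech_tanh_coeff (Suc i) m = fact i * fps_nth (fps_deriv (fps_sech * fps_tanh ^ m)) i"
    by (simp add: sech_tanh_coeff_def fps_deriv_nth del: fps_deriv_mult)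
  then show ?thesis
    unfolding fps_deriv_sech_tanh_power
    by (simp only: sech_tanh_coeff_def fps_of_nat[symmetric] fps_sub_nth fps_mult_left_const_nth)
      (simp only: right_diff_distrib mult.left_commute)
qed

lemma sech_tanh_coeff_0: "sech_tanh_coeff 0 m = (if m = 0 then 1 else 0)"
  by (simp add: sech_tanh_coeff_def fps_sech_nth_0 fps_tanh_nth_0 fps_nth_power_0)

lemma sech_tanh_coeff_gt: "i < m \<Longrightarrow> sech_tanh_coeff i m = 0"
  by (induction i arbitrary: m) (simp_all add: sech_tanh_coeff_0 sech_tanh_coeff_Suc)

text \<open>Since sech is even and tanh is odd, the series has the parity of \<open>m\<close>. In
  the recurrence both indices move by one, so induction preserves the parity.\<close>

lemma sech_tanh_coeff_odd: "odd (i + m) \<Longrightarrow> sech_tanh_coeff i m = 0"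
proof (induction i arbitrary: m)
  case 0
  then show ?case by (cases m) (simp_all add: sech_tanh_coeff_0)
next
  case (Suc i)
  then show ?case by (cases m) (simp_all add: sech_tanh_coeff_Suc)
qed

lemma sech_tanh_coeff_diag: "sech_tanh_coeff i i = fact i"
  by (induction i) (simp_all add: sech_tanh_coeff_0 sech_tanh_coeff_Suc sech_tanh_coeff_gt)

text \<open>This is the addition formula for sech, proved on coefficients. Moving one unit from
  \<open>i\<close> to \<open>j\<close> leaves the sum unchanged, and at \<open>i = 0\<close> only
  the term \<open>m = 0\<close> survives.\<close>

lemma sum_sech_tanh_coeff:
  assumes "i < N"
  shows "(\<Sum>m<N. (-1) ^ m * sech_tanh_coeff i m * sech_tanh_coeff j m) = euler_number (i + j)"
  using assms
proof (induction i arbitrary: j)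
  case 0
  then have "(\<Sum>m<N. (-1) ^ m * sech_tanh_coeff 0 m * sech_tanh_coeff j m)
      = (\<Sum>m<N. if m = 0 then sech_tanh_coeff j 0 else 0)"
    by (intro sum.cong) (simp_all add: sech_tanh_coeff_0)
  with 0 show ?case by (simp add: euler_number_eq_coeff)
next
  case (Suc i)
  let ?B = sech_tanh_coeff
  \<comment> \<open>After the recurrence is applied to both products, what remains pairs the
    neighbouring columns \<open>m - 1\<close> and \<open>m\<close>, with weight
    \<open>m\<close>.\<close>
  define g where "g m = (-1) ^ m * real m * (?B i (m - 1) * ?B j m - ?B i m * ?B j (m - 1))" for m
  have "(-1) ^ m * ?B (Suc i) m * ?B j m - (-1) ^ m * ?B i m * ?B (Suc j) m = g m - g (Suc m)" for m
    by (simp add: g_def sech_tanh_coeff_Suc algebra_simps)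
  then have "(\<Sum>m<N. (-1) ^ m * ?B (Suc i) m * ?B j m) - (\<Sum>m<N. (-1) ^ m * ?B i m * ?B (Suc j) m)
      = g 0 - g N"
    by (simp add: sum_lessThan_telescope' flip: sum_subtractf)
  also have "\<dots> = 0"
    \<comment> \<open>The bound \<open>Suc i < N\<close> gives \<open>i < N - 1\<close>, so both
      products in \<open>g N\<close> have a zero factor.\<close>
    using Suc.prems by (simp add: g_def sech_tanh_coeff_gt)
  finally show ?case using Suc by simp
qed

lemma sum_lessThan_double:
  fixes f :: "nat \<Rightarrow> 'a :: comm_monoid_add"
  shows "(\<Sum>m<2 * n. f m) = (\<Sum>m<n. f (2 * m)) + (\<Sum>m<n. f (2 * m + 1))"
  by (induction n) (simp_all add: ac_simps)

text \<open>By parity only even columns contribute, and these carry the sign \<open>+1\<close>; for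
  odd rows only odd columns do, with the sign \<open>-1\<close>.\<close>

lemma euler_number_even_decomp:
  assumes "i < N"
  shows "euler_number (2 * (i + j)) =
    (\<Sum>m<N. sech_tanh_coeff (2 * i) (2 * m) * sech_tanh_coeff (2 * j) (2 * m))"
  using sum_sech_tanh_coeff[of "2 * i" "2 * N" "2 * j"] assms
  by (simp add: sum_lessThan_double sech_tanh_coeff_odd distrib_left)

lemma euler_number_odd_decomp:
  assumes "i < N"
  shows "euler_number (2 * (i + j) + 2) =
    - (\<Sum>m<N. sech_tanh_coeff (2 * i + 1) (2 * m + 1) * sech_tanh_coeff (2 * j + 1) (2 * m + 1))"
  using sum_sech_tanh_coeff[of "2 * i + 1" "2 * N" "2 * j + 1"] assms
  by (simp add: sum_lessThan_double sech_tanh_coeff_odd distrib_left sum_negf)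

section \<open>Coordinates of the border vector\<close>

definition border_coeff :: "nat \<Rightarrow> real" where
  "border_coeff m = 4 ^ m * fact m ^ 2 / fact (2 * m + 1)"

text \<open>This ratio is what makes the sum in \<open>sum_border_coeff\<close> telescope.\<close>

lemma border_coeff_Suc:
  "border_coeff (Suc m) * real (2 * m + 3) = border_coeff m * real (2 * m + 2)"
proof -
  have "fact (2 * Suc m + 1) = real (2 * m + 3) * real (2 * m + 2) * fact (2 * m + 1)"
    by (simp add: algebra_simps)
  moreover have "fact (Suc m) = real (m + 1) * fact m" by simp
  ultimately show ?thesis
    unfolding border_coeff_def by (simp add: divide_simps power2_eq_square del: fact_Suc) (simp add: algebra_simps)
qed

lemma border_coeff_square:
  "border_coeff m ^ 2 = 16 ^ m / (real (2 * m + 1) ^ 2 * real ((2 * m) choose m) ^ 2)"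
proof -
  have "real ((2 * m) choose m) = fact (2 * m) / fact m ^ 2"
    by (simp add: binomial_fact power2_eq_square)
  moreover have "(4 ^ m) ^ 2 = (16 :: real) ^ m"
    by (simp add: power2_eq_square flip: power_mult_distrib)
  moreover have "fact (2 * m + 1) = real (2 * m + 1) * fact (2 * m)" by simp
  ultimately show ?thesis
    unfolding border_coeff_def by (simp add: power_divide power_mult_distrib del: fact_Suc)
qed

lemma K_sum_eq: "K_sum n = (\<Sum>m<n. border_coeff m ^ 2)"
  unfolding K_sum_def border_coeff_square by (simp add: lessThan_atLeast0)

text \<open>The \<open>border_coeff m\<close> are the coefficients of \<open>x^(2m+1)\<close> in
  \<open>arcsin x / sqrt (1 - x^2)\<close>. At \<open>x = tanh t\<close>, multiplying by
  \<open>sech t\<close> gives the Gudermannian, whose derivative is \<open>sech t\<close>.\<close>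

lemma sum_border_coeff:
  assumes "j < N"
  shows "(\<Sum>m<N. border_coeff m * sech_tanh_coeff (2 * j + 1) (2 * m + 1)) = euler_number (2 * j)"
proof -
  \<comment> \<open>The first term of the recurrence for column \<open>2 * m + 1\<close> is
    \<open>g m\<close>; \<open>border_coeff_Suc\<close> turns the second into
    \<open>g (Suc m)\<close>.\<close>
  define g where "g m = border_coeff m * real (2 * m + 1) * sech_tanh_coeff (2 * j) (2 * m)" for m
  have "border_coeff m * sech_tanh_coeff (2 * j + 1) (2 * m + 1) = g m - g (Suc m)" for m
  proof -
    have "g (Suc m) = border_coeff m * real (2 * m + 2) * sech_tanh_coeff (2 * j) (2 * m + 2)"
      using border_coeff_Suc[of m] by (simp add: g_def algebra_simps)
    then show ?thesis
      by (simp add: g_def sech_tanh_coeff_Suc algebra_simps)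
  qed
  then have "(\<Sum>m<N. border_coeff m * sech_tanh_coeff (2 * j + 1) (2 * m + 1)) = g 0 - g N"
    by (simp add: sum_lessThan_telescope')
  also have "\<dots> = euler_number (2 * j)"
    using assms by (simp add: g_def sech_tanh_coeff_gt euler_number_eq_coeff border_coeff_def)
  finally show ?thesis .
qed

section \<open>Hankel determinants by congruence with diagonal matrices\<close>

lemma det_mat_lower_triangular:
  fixes f :: "nat \<Rightarrow> nat \<Rightarrow> 'a :: idom"
  assumes "\<And>i j. i < j \<Longrightarrow> j < N \<Longrightarrow> f i j = 0"
  shows "det (mat N N (\<lambda>(i, j). f i j)) = (\<Prod>i<N. f i i)"
proof -
  have "det (mat N N (\<lambda>(i, j). f i j)) = prod_list (diag_mat (mat N N (\<lambda>(i, j). f i j)))"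
    by (rule det_lower_triangular[of N]) (auto simp: assms)
  also have "\<dots> = (\<Prod>i<N. f i i)"
    by (simp add: prod_list_diag_prod lessThan_atLeast0)
  finally show ?thesis .
qed

lemma det_congruence_diag:
  fixes R :: "nat \<Rightarrow> nat \<Rightarrow> 'a :: idom"
  shows "det (mat N N (\<lambda>(i, j). \<Sum>m<N. R i m * d m * R j m))
    = det (mat N N (\<lambda>(i, j). R i j)) ^ 2 * (\<Prod>m<N. d m)"
proof -
  define A where "A = mat N N (\<lambda>(i, j). R i j)"
  define D where "D = mat N N (\<lambda>(i, j). if i = j then d i else 0)"
  have carr: "A \<in> carrier_mat N N" "D \<in> carrier_mat N N"
    by (simp_all add: A_def D_def)
  have AD: "A * D = mat N N (\<lambda>(i, j). R i j * d j)"
  proof (rule eq_matI)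
    fix i j assume "i < dim_row (mat N N (\<lambda>(i, j). R i j * d j))"
      and "j < dim_col (mat N N (\<lambda>(i, j). R i j * d j))"
    then show "(A * D) $$ (i, j) = mat N N (\<lambda>(i, j). R i j * d j) $$ (i, j)"
      by (simp add: A_def D_def scalar_prod_def if_distrib[of "\<lambda>x. _ * x"] cong: if_cong)
  qed (simp_all add: A_def D_def)
  have "mat N N (\<lambda>(i, j). \<Sum>m<N. R i m * d m * R j m) = A * D * transpose_mat A"
    unfolding AD by (rule eq_matI) (simp_all add: A_def scalar_prod_def lessThan_atLeast0)
  also have "det \<dots> = det A * det D * det A"
    using carr by (simp add: det_mult[of _ N] det_transpose[of _ N])
  also have "det D = (\<Prod>m<N. d m)"
    unfolding D_def by (subst det_mat_lower_triangular) simp_all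
  finally show ?thesis by (simp add: A_def power2_eq_square)
qed

lemma hankel_det_euler_number_even:
  "hankel_det n (\<lambda>k. euler_number (2 * k)) = (\<Prod>m<n + 1. fact (2 * m)) ^ 2"
proof -
  let ?R = "\<lambda>i m. sech_tanh_coeff (2 * i) (2 * m)"
  have "mat (n + 1) (n + 1) (\<lambda>(i, j). euler_number (2 * (i + j)))
      = mat (n + 1) (n + 1) (\<lambda>(i, j). \<Sum>m<n + 1. ?R i m * 1 * ?R j m)"
    by (rule eq_matI) (simp_all add: euler_number_even_decomp[where N = "n + 1"] del: sum.lessThan_Suc distrib_left_numeral)
  then have "hankel_det n (\<lambda>k. euler_number (2 * k))
      = det (mat (n + 1) (n + 1) (\<lambda>(i, j). ?R i j)) ^ 2"
    unfolding hankel_det_def by (simp only: det_congruence_diag) simp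
  also have "det (mat (n + 1) (n + 1) (\<lambda>(i, j). ?R i j)) = (\<Prod>m<n + 1. ?R m m)"
    by (rule det_mat_lower_triangular) (simp add: sech_tanh_coeff_gt)
  finally show ?thesis by (simp add: sech_tanh_coeff_diag)
qed

text \<open>With \<open>u\<close> the row of \<open>border_coeff\<close> and \<open>L\<close> the
  odd part of the coefficient matrix, this has the blocks \<open>1\<close>, \<open>-u\<close>,
  \<open>0\<close>, \<open>L\<close>. Congruence with the diagonal
  \<open>K_sum n, -1, ..., -1\<close> then produces the Hankel matrix of
  \<open>b_seq\<close>.\<close>

fun border_factor :: "nat \<Rightarrow> nat \<Rightarrow> real" where
  "border_factor 0 0 = 1"
| "border_factor 0 (Suc m) = - border_coeff m"
| "border_factor (Suc i) 0 = 0"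
| "border_factor (Suc i) (Suc m) = sech_tanh_coeff (2 * i + 1) (2 * m + 1)"

lemma det_border_factor:
  "det (mat (n + 1) (n + 1) (\<lambda>(i, j). border_factor i j)) = (\<Prod>m<n. fact (2 * m + 1))"
proof -
  let ?L = "mat n n (\<lambda>(i, j). sech_tanh_coeff (2 * i + 1) (2 * j + 1))"
  have "mat (n + 1) (n + 1) (\<lambda>(i, j). border_factor i j)
      = four_block_mat (mat 1 1 (\<lambda>_. 1)) (mat 1 n (\<lambda>(i, j). - border_coeff j)) (0\<^sub>m n 1) ?L"
    (is "?A = ?B")
  proof (rule eq_matI)
    fix i j assume "i < dim_row ?B" "j < dim_col ?B"
    then show "?A $$ (i, j) = ?B $$ (i, j)"
      by (cases i; cases j) simp_all
  qed simp_all
  also have "det \<dots> = det (mat 1 1 (\<lambda>_. 1 :: real)) * det ?L"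
    by (rule det_four_block_mat_lower_left_zero[of _ 1 _ n]) simp_all
  also have "det (mat 1 1 (\<lambda>_. 1 :: real)) = 1"
    by (simp add: det_single)
  also have "det ?L = (\<Prod>m<n. sech_tanh_coeff (2 * m + 1) (2 * m + 1))"
    by (rule det_mat_lower_triangular) (simp add: sech_tanh_coeff_gt)
  finally show ?thesis by (simp only: sech_tanh_coeff_diag mult_1)
qed

text \<open>The corner is \<open>K_sum n\<close> minus the squared length of \<open>u\<close>, which
  is zero. The border entries come from \<open>sum_border_coeff\<close>, the interior from
  \<open>euler_number_odd_decomp\<close>.\<close>

lemma b_seq_decomp:
  assumes "i < n + 1" "j < n + 1"
  shows "b_seq (i + j) = (\<Sum>m<n + 1.
    border_factor i m * (if m = 0 then K_sum n else - 1) * border_factor j m)"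
proof (cases i; cases j)
  assume "i = 0" "j = 0"
  then show ?thesis
    by (simp add: b_seq_def K_sum_eq sum.lessThan_Suc_shift power2_eq_square sum_negf
        del: sum.lessThan_Suc)
next
  fix j' assume "i = 0" "j = Suc j'"
  then show ?thesis
    using sum_border_coeff[of j' n] assms
    by (simp add: b_seq_def sum.lessThan_Suc_shift del: sum.lessThan_Suc)
next
  fix i' assume "i = Suc i'" "j = 0"
  then show ?thesis
    using sum_border_coeff[of i' n] assms
    by (simp add: b_seq_def sum.lessThan_Suc_shift mult.commute del: sum.lessThan_Suc)
next
  fix i' j' assume "i = Suc i'" "j = Suc j'"
  then show ?thesis
    using euler_number_odd_decomp[of i' n j'] assms
    by (simp add: b_seq_def sum.lessThan_Suc_shift sum_negf del: sum.lessThan_Suc)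
qed

lemma hankel_det_b_seq:
  "hankel_det n b_seq = (-1) ^ n * K_sum n * (\<Prod>m<n. fact (2 * m + 1)) ^ 2"
proof -
  let ?d = "\<lambda>m. if m = 0 then K_sum n else - 1"
  have "mat (n + 1) (n + 1) (\<lambda>(i, j). b_seq (i + j))
      = mat (n + 1) (n + 1) (\<lambda>(i, j). \<Sum>m<n + 1. border_factor i m * ?d m * border_factor j m)"
    by (rule eq_matI) (simp_all add: b_seq_decomp[of _ n] del: sum.lessThan_Suc)
  then have "hankel_det n b_seq = (\<Prod>m<n. fact (2 * m + 1)) ^ 2 * (\<Prod>m<n + 1. ?d m)"
    unfolding hankel_det_def by (simp only: det_congruence_diag det_border_factor)
  also have "(\<Prod>m<n + 1. ?d m) = K_sum n * (-1) ^ n"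
    by (simp add: prod.lessThan_Suc_shift del: prod.lessThan_Suc)
  finally show ?thesis by (simp only: ac_simps)
qed

text \<open>Squared, this ratio of the two diagonal products is the factor
  \<open>4 ^ n * (fact n) ^ 2\<close> of the theorem.\<close>

lemma prod_fact_even_eq:
  "(\<Prod>m<n + 1. fact (2 * m)) = 2 ^ n * fact n * (\<Prod>m<n. fact (2 * m + 1) :: real)"
proof (induction n)
  case (Suc n)
  have "fact (2 * Suc n) = 2 * real (Suc n) * fact (2 * n + 1)" by (simp add: algebra_simps)
  with Suc show ?case by simp
qed simp

theorem proposition7p3:
  fixes n :: nat
  assumes "n \<ge> 1"
  shows "hankel_det n b_seq =
    (-1) ^ n / (4 ^ n * (fact n) ^ 2) * K_sum n * hankel_det n (\<lambda>k. euler_number (2 * k))"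
proof -
  have "(2 ^ n) ^ 2 = (4 :: real) ^ n"
    by (simp add: power2_eq_square flip: power_mult_distrib)
  then show ?thesis
    unfolding hankel_det_b_seq hankel_det_euler_number_even prod_fact_even_eq
    by (simp add: power_mult_distrib)
qed

end
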